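(* For each $\lambda\in P_n=\{\lambda\in\mathbb Z^n: 0\le\lambda_1\le\cdots\le\lambda_n\}$, the permutohedron $$\mathbf P(\lambda)=\mathrm{conv}\{(\lambda_{\sigma(1)},\dots,\lambda_{\sigma(n)}):\sigma\in\mathfrak S_n\}\subset\mathbb R^n$$ is a normal polytope.
   Context: A convex lattice polytope $\mathbf P\subset\mathbb R^n$ is normal (has the integer decomposition property) if for every positive integer $d$, every point of $\mathbb Z^n$ in the dilation $d\cdot\mathbf P$ can be written as the sum of exactly $d$ points of $\mathbb Z^n$ lying in $\mathbf P$. *)

theory Defs
  imports "HOL-Analysis.Analysis"
begin

definition integer_points :: "(real ^ 'n) set" where
  "integer_points = {x. \<forall>i. x $ i \<in> \<int>}"

definition lattice_polytope :: "(real ^ 'n) set \<Rightarrow> bool" where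
  "lattice_polytope P \<longleftrightarrow>
     (\<exists>V. finite V \<and> V \<subseteq> integer_points \<and> P = convex hull V)"

text \<open>The integer decomposition property. The summands are given as a family, so that
  repetitions are allowed.\<close>

definition normal_polytope :: "(real ^ 'n) set \<Rightarrow> bool" where
  "normal_polytope P \<longleftrightarrow>
     lattice_polytope P \<and>
     (\<forall>d::nat. d > 0 \<longrightarrow>
       (\<forall>x \<in> (\<lambda>p. real d *\<^sub>R p) ` P \<inter> integer_points.
         \<exists>y :: nat \<Rightarrow> real ^ 'n.
           (\<forall>k<d. y k \<in> P \<inter> integer_points) \<and> x = (\<Sum>k<d. y k)))"

text \<open>The index set 1 < ... < n is represented by a finite linearly ordered type
  with n elements.\<close>

definition nonneg_weakly_increasing :: "(int ^ 'n::{finite,linorder}) set" where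
  "nonneg_weakly_increasing =
     {l. (\<forall>i. 0 \<le> l $ i) \<and> (\<forall>i j. i \<le> j \<longrightarrow> l $ i \<le> l $ j)}"

definition permutohedron :: "int ^ 'n \<Rightarrow> (real ^ 'n) set" where
  "permutohedron l =
     convex hull {(\<chi> i. real_of_int (l $ \<sigma> i)) | \<sigma>. \<sigma> permutes (UNIV :: 'n set)}"

end

theory Submission
  imports Defs
begin

text \<open>An integer point of the dilate satisfies the same prefix-sum inequalities as the dilated
  vertices, so after sorting its coordinates it is reached from the dilated vector by unit transfers
  from a larger to a smaller coordinate (Muirhead). Sums of integer points of the permutohedron
  are closed under such transfers: if the sum has a larger entry at one place than at another,
  then so has a summand, and the transfer within that summand stays on the segment
  between the summand and its image under the transposition of the two places.\<close>

section \<open>Integer points as integer-valued functions, and unit transfers between them\<close>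

definition vec_of_int :: "('n \<Rightarrow> int) \<Rightarrow> real ^ 'n" where
  "vec_of_int z = (\<chi> i. real_of_int (z i))"

lemma vec_of_int_nth [simp]: "vec_of_int z $ i = real_of_int (z i)"
  by (simp add: vec_of_int_def)

lemma vec_of_int_in_integer_points [simp]: "vec_of_int z \<in> integer_points"
  by (simp add: integer_points_def)

lemma integer_pointsE:
  assumes "x \<in> integer_points"
  obtains z where "x = vec_of_int z"
proof
  show "x = vec_of_int (\<lambda>i. \<lfloor>x $ i\<rfloor>)"
    using assms by (simp add: vec_eq_iff integer_points_def)
qed

text \<open>For \<open>z i < z j\<close> this is the Robin Hood transfer of majorization theory, by
  one unit. The giver \<open>j\<close> is named before the receiver \<open>i\<close>.\<close>

definition unit_transfer :: "'a \<Rightarrow> 'a \<Rightarrow> ('a \<Rightarrow> int) \<Rightarrow> 'a \<Rightarrow> int" where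
  "unit_transfer j i z = z(i := z i + 1, j := z j - 1)"

lemma sum_unit_transfer:
  assumes "finite A" "i \<noteq> j"
  shows "sum (unit_transfer j i z) A = sum z A + of_bool (i \<in> A) - of_bool (j \<in> A)"
proof -
  have "unit_transfer j i z = (\<lambda>m. z m + (if m = i then 1 else 0) - (if m = j then 1 else 0))"
    using assms(2) by (auto simp: unit_transfer_def fun_eq_iff)
  then show ?thesis
    using assms(1) by (simp add: sum.distrib sum_subtractf)
qed

text \<open>Induction on the l1 distance from \<open>z\<close> to \<open>x\<close>. An excess at
  \<open>j\<close> and the prefix inequality there force a deficit at some \<open>i < j\<close>. As
  \<open>x\<close> is sorted, z i < x i \<le> x j < z j, so the transfer from \<open>j\<close> to
  \<open>i\<close> is permitted and brings \<open>z\<close> closer to \<open>x\<close>. Only the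
  target is sorted: the intermediate vectors may be in any order.\<close>

lemma mem_if_closed_under_unit_transfers:
  fixes x z :: "'n::{finite,linorder} \<Rightarrow> int"
  assumes closed: "\<And>z i j. z \<in> R \<Longrightarrow> z i < z j \<Longrightarrow> unit_transfer j i z \<in> R"
    and "mono x" "z \<in> R"
    and "\<And>k. sum z {..k} \<le> sum x {..k}" "sum z UNIV = sum x UNIV"
  shows "x \<in> R"
  using assms(3-)
proof (induction "nat (\<Sum>i\<in>UNIV. \<bar>z i - x i\<bar>)" arbitrary: z rule: less_induct)
  case less
  show ?case
  proof (cases "\<exists>j. z j > x j")
    case False
    then have "\<And>i. z i \<le> x i"
      by (simp add: not_less)
    then have "z i = x i" for i
      using sum_mono_inv[OF less.prems(3)] by simp
    then show ?thesis
      using less.prems(1) by (metis ext)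
  next
    case True
    \<comment> \<open>Taking the first excess ensures that no entry before \<open>j\<close> exceeds
      its target; the prefix inequalities survive the transfer for this reason.\<close>
    define j where "j = Min {j. z j > x j}"
    have "j \<in> {j. z j > x j}"
      unfolding j_def using True by (intro Min_in) auto
    then have j: "z j > x j"
      by simp
    have below: "z m \<le> x m" if "m < j" for m
      using that Min_le[of "{j. z j > x j}" m] unfolding j_def
      by (metis finite mem_Collect_eq not_less)
    have "\<exists>i<j. z i < x i"
    proof (rule ccontr)
      assume "\<not> (\<exists>i<j. z i < x i)"
      then have "\<forall>i\<le>j. x i \<le> z i"
        using j by (metis le_less not_less)
      then have "sum x {..j} < sum z {..j}"
        using j by (intro sum_strict_mono_ex1) auto
      then show False
        using less.prems(2)[of j] by simp
    qed
    then obtain i where i: "i < j" "z i < x i"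
      by blast
    have "x i \<le> x j"
      using i(1) by (intro monoD[OF \<open>mono x\<close>]) simp
    then have lt: "z i < z j"
      using i j by simp
    let ?z = "unit_transfer j i z"
    \<comment> \<open>Only the prefixes containing \<open>i\<close> but not \<open>j\<close> grow,
      and by one. On these \<open>z\<close> is bounded by \<open>x\<close> entrywise and strictly at
      \<open>i\<close>, so by integrality there is room for one unit.\<close>
    have prefix: "sum ?z {..k} \<le> sum x {..k}" for k
    proof (cases "i \<le> k \<and> k < j")
      case True
      have "sum z {..k} < sum x {..k}"
        using True i below by (intro sum_strict_mono_ex1) auto
      then show ?thesis
        using True i by (simp add: sum_unit_transfer)
    next
      case False
      then show ?thesis
        using less.prems(2)[of k] i by (auto simp: sum_unit_transfer)
    qed
    have total: "sum ?z UNIV = sum x UNIV"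
      using less.prems(3) i by (simp add: sum_unit_transfer)
    have "(\<Sum>m\<in>UNIV. \<bar>?z m - x m\<bar>) < (\<Sum>m\<in>UNIV. \<bar>z m - x m\<bar>)"
      using i j by (intro sum_strict_mono_ex1) (auto simp: unit_transfer_def)
    moreover have "0 \<le> (\<Sum>m\<in>UNIV. \<bar>?z m - x m\<bar>)"
      by (intro sum_nonneg) auto
    ultimately have "nat (\<Sum>m\<in>UNIV. \<bar>?z m - x m\<bar>) < nat (\<Sum>m\<in>UNIV. \<bar>z m - x m\<bar>)"
      by linarith
    then show ?thesis
      using less.hyps closed[OF less.prems(1) lt] prefix total by blast
  qed
qed

section \<open>Prefix sums of monotone functions, and sorting by a permutation\<close>

lemma sum_prefix_le_sum:
  fixes f :: "'n::{finite,linorder} \<Rightarrow> 'b::linordered_idom"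
  assumes "mono f" "card T = card {..k}"
  shows "sum f {..k} \<le> sum f T"
proof -
  \<comment> \<open>An exchange argument: the places lost and the places gained are equally many,
    and \<open>f k\<close> bounds the values from above on the lost ones and from below on the
    gained ones.\<close>
  have card: "card ({..k} - T) = card (T - {..k})"
    using assms(2) card_Diff_subset_Int[of "{..k}" T] card_Diff_subset_Int[of T "{..k}"]
    by (simp add: Int_commute)
  have "sum f {..k} = sum f ({..k} \<inter> T) + sum f ({..k} - T)"
    by (simp add: sum.Int_Diff[symmetric])
  also have "sum f ({..k} - T) \<le> of_nat (card ({..k} - T)) * f k"
    using assms(1) by (intro sum_bounded_above) (auto dest: monoD)
  also have "\<dots> = of_nat (card (T - {..k})) * f k"
    using card by simp
  also have "\<dots> \<le> sum f (T - {..k})"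
    using assms(1) by (intro sum_bounded_below) (auto simp: not_le dest: monoD[OF _ less_imp_le])
  also have "sum f ({..k} \<inter> T) + sum f (T - {..k}) = sum f T"
    by (simp add: sum.Int_Diff[of T f "{..k}"] Int_commute)
  finally show ?thesis
    by simp
qed

lemma exists_sorting_permutation:
  fixes f :: "'n::{finite,linorder} \<Rightarrow> 'b::linorder"
  obtains \<pi> where "\<pi> permutes UNIV" "mono (f \<circ> \<pi>)"
proof -
  \<comment> \<open>\<open>us\<close> lists the type in its own order and \<open>vs\<close> by
    increasing value of \<open>f\<close>. The permutation sends each entry of \<open>us\<close> to
    the entry of \<open>vs\<close> at the same position.\<close>
  define us where "us = sorted_list_of_set (UNIV :: 'n set)"
  define vs where "vs = sort_key f us"
  have us: "distinct us" "set us = UNIV" "sorted us"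
    by (auto simp: us_def)
  have vs: "distinct vs" "set vs = UNIV" "length vs = length us" "sorted (map f vs)"
    using us by (auto simp: vs_def)
  have bu: "bij_betw ((!) us) {..<length us} UNIV"
    using us by (intro bij_betw_nth) auto
  have bv: "bij_betw ((!) vs) {..<length us} UNIV"
    using vs by (intro bij_betw_nth) auto
  define pos where "pos = inv_into {..<length us} ((!) us)"
  have bpos: "bij_betw pos UNIV {..<length us}"
    unfolding pos_def by (rule bij_betw_inv_into[OF bu])
  have pos: "us ! pos i = i" "pos i < length us" for i
    using bij_betw_inv_into_right[OF bu, of i] bij_betwE[OF bpos] by (auto simp: pos_def)
  have mono_pos: "pos i \<le> pos j" if "i \<le> j" for i j
  proof (rule ccontr)
    assume "\<not> pos i \<le> pos j"
    then have "us ! pos j \<le> us ! pos i"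
      using us(3) pos(2) by (intro sorted_nth_mono) auto
    with that \<open>\<not> pos i \<le> pos j\<close> show False
      by (simp add: pos)
  qed
  show thesis
  proof
    have "bij ((!) vs \<circ> pos)"
      by (rule bij_betw_trans[OF bpos bv])
    then show "((!) vs \<circ> pos) permutes UNIV"
      by (simp add: permutes_def bij_iff)
    show "mono (f \<circ> ((!) vs \<circ> pos))"
    proof (rule monoI)
      fix i j :: 'n
      assume "i \<le> j"
      then have "map f vs ! pos i \<le> map f vs ! pos j"
        using vs pos(2) mono_pos by (intro sorted_nth_mono) auto
      then show "(f \<circ> ((!) vs \<circ> pos)) i \<le> (f \<circ> ((!) vs \<circ> pos)) j"
        using vs pos(2) by simp
    qed
  qed
qed

section \<open>The permutohedron: symmetry, unit transfers and sum conditions\<close>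

lemma permutohedron_vertex:
  "\<sigma> permutes UNIV \<Longrightarrow> vec_of_int (\<lambda>i. l $ \<sigma> i) \<in> permutohedron l"
  unfolding permutohedron_def vec_of_int_def by (intro hull_inc) auto

text \<open>For a property that is the linear preimage of a convex set, only the vertices remain to
  be checked. Symmetry and both sum conditions are obtained in this way.\<close>

lemma permutohedron_induct [consumes 1, case_names vertex convex]:
  assumes "p \<in> permutohedron l"
    and "\<And>\<sigma>. \<sigma> permutes UNIV \<Longrightarrow> Q (vec_of_int (\<lambda>i. l $ \<sigma> i))"
    and "convex {p. Q p}"
  shows "Q p"
  using assms(1) unfolding permutohedron_def
proof (rule hull_induct)
  fix p assume "p \<in> {(\<chi> i. real_of_int (l $ \<sigma> i)) |\<sigma>. \<sigma> permutes UNIV}"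
  then show "Q p"
    using assms(2) by (auto simp: vec_of_int_def)
qed (use assms(3) in auto)

lemma permutohedron_permute:
  assumes "p \<in> permutohedron l" and \<pi>: "\<pi> permutes UNIV"
  shows "(\<chi> i. p $ \<pi> i) \<in> permutohedron l"
  using assms(1)
proof (induction rule: permutohedron_induct)
  case (vertex \<sigma>)
  have "vec_of_int (\<lambda>i. l $ (\<sigma> \<circ> \<pi>) i) \<in> permutohedron l"
    by (rule permutohedron_vertex[OF permutes_compose[OF \<pi> vertex]])
  then show ?case
    by (simp add: vec_of_int_def)
next
  case convex
  have "linear (\<lambda>p :: real ^ 'a. \<chi> i. p $ \<pi> i)"
    by (rule linearI) (simp_all add: vec_eq_iff)
  moreover have "convex (permutohedron l)"
    by (simp add: permutohedron_def)
  ultimately show ?case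
    using convex_linear_vimage by (simp add: vimage_def)
qed

lemma permutohedron_unit_transfer:
  assumes q: "vec_of_int q \<in> permutohedron l" and lt: "q i < q j"
  shows "vec_of_int (unit_transfer j i q) \<in> permutohedron l"
proof -
  \<comment> \<open>The full transposition carries \<open>q j - q i\<close> units from
    \<open>j\<close> to \<open>i\<close>, so going this fraction of the way carries exactly one.
    Integrality makes the gap at least 1, which gives t \<le> 1.\<close>
  define t where "t = 1 / real_of_int (q j - q i)"
  have ge: "1 \<le> real_of_int (q j - q i)"
    using lt by linarith
  have t: "0 \<le> t" "t \<le> 1" "t * (real_of_int (q j) - real_of_int (q i)) = 1"
    using ge by (auto simp: t_def)
  let ?s = "\<chi> m. vec_of_int q $ Transposition.transpose i j m"
  have "?s \<in> permutohedron l"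
    by (intro permutohedron_permute q permutes_swap_id) auto
  moreover have "convex (permutohedron l)"
    by (simp add: permutohedron_def)
  ultimately have "(1 - t) *\<^sub>R vec_of_int q + t *\<^sub>R ?s \<in> permutohedron l"
    using q t by (intro convexD) auto
  moreover have "(1 - t) *\<^sub>R vec_of_int q + t *\<^sub>R ?s = vec_of_int (unit_transfer j i q)"
  proof -
    have "(1 - t) * real_of_int (q m) + t * real_of_int (q (Transposition.transpose i j m))
        = real_of_int (unit_transfer j i q m)" for m
      using t(3) lt by (auto simp: unit_transfer_def Transposition.transpose_def algebra_simps)
    then show ?thesis
      by (simp add: vec_eq_iff)
  qed
  ultimately show ?thesis
    by simp
qed

text \<open>At a vertex the prefix sum adds entries of \<open>l\<close> over as many places as the
  prefix has, and for increasing \<open>l\<close> the initial segment minimizes such sums. The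
  inequality describes a half-space, so it passes to the hull.\<close>

lemma permutohedron_prefix_sum:
  fixes l :: "int ^ 'n::{finite,linorder}"
  assumes "mono (($) l)" "p \<in> permutohedron l"
  shows "(\<Sum>i\<le>k. real_of_int (l $ i)) \<le> (\<Sum>i\<le>k. p $ i)"
  using assms(2)
proof (induction rule: permutohedron_induct)
  case (vertex \<sigma>)
  have inj: "inj_on \<sigma> {..k}"
    using vertex by (meson permutes_inj subset_UNIV inj_on_subset)
  have "(\<Sum>i\<le>k. l $ i) \<le> sum (($) l) (\<sigma> ` {..k})"
    using assms(1) card_image[OF inj] by (intro sum_prefix_le_sum)
  also have "\<dots> = (\<Sum>i\<le>k. l $ \<sigma> i)"
    using inj by (simp add: sum.reindex)
  finally have "real_of_int (\<Sum>i\<le>k. l $ i) \<le> real_of_int (\<Sum>i\<le>k. l $ \<sigma> i)"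
    by (simp only: of_int_le_iff)
  then show ?case
    by simp
next
  case convex
  have "linear (\<lambda>p :: (real, 'n) vec. \<Sum>i\<le>k. p $ i)"
    by (rule linearI) (simp_all add: sum.distrib sum_distrib_left)
  from convex_linear_vimage[OF this convex_real_interval(1)] show ?case
    by (simp add: vimage_def)
qed

lemma permutohedron_total_sum:
  assumes "p \<in> permutohedron l"
  shows "(\<Sum>i\<in>UNIV. p $ i) = (\<Sum>i\<in>UNIV. real_of_int (l $ i))"
  using assms
proof (induction rule: permutohedron_induct)
  case (vertex \<sigma>)
  then show ?case
    using sum.permute[OF vertex, of "\<lambda>i. real_of_int (l $ i)"] by (simp add: o_def)
next
  case convex
  have "linear (\<lambda>p :: real ^ 'a. \<Sum>i\<in>UNIV. p $ i)"
    by (rule linearI) (simp_all add: sum.distrib sum_distrib_left)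
  from convex_linear_vimage[OF this convex_singleton] show ?case
    by (simp add: vimage_def)
qed

section \<open>Normality: lattice vertices and sums of lattice points\<close>

lemma lattice_polytope_permutohedron: "lattice_polytope (permutohedron l)"
  unfolding lattice_polytope_def permutohedron_def
proof (intro exI conjI refl)
  show "finite {(\<chi> i. real_of_int (l $ \<sigma> i)) | \<sigma>. \<sigma> permutes UNIV}"
    by (intro finite_image_set finite_permutations) simp
qed (auto simp: integer_points_def)

text \<open>The vectors that decompose as normality demands, kept integer-valued so that unit
  transfers apply to the sum and to each summand alike.\<close>

definition lattice_sums :: "nat \<Rightarrow> (real ^ 'n) set \<Rightarrow> ('n \<Rightarrow> int) set" where
  "lattice_sums d P =
     {\<lambda>i. \<Sum>k<d. y k i | y. \<forall>k<d. vec_of_int (y k) \<in> P}"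

lemma lattice_sums_permutohedron_unit_transfer:
  assumes "z \<in> lattice_sums d (permutohedron l)" "z i < z j"
  shows "unit_transfer j i z \<in> lattice_sums d (permutohedron l)"
proof -
  obtain y where y: "\<And>k. k < d \<Longrightarrow> vec_of_int (y k) \<in> permutohedron l"
    and z: "z = (\<lambda>i. \<Sum>k<d. y k i)"
    using assms(1) by (auto simp: lattice_sums_def)
  have "\<exists>k<d. y k i < y k j"
  proof (rule ccontr)
    assume "\<not> (\<exists>k<d. y k i < y k j)"
    then have "z j \<le> z i"
      unfolding z by (intro sum_mono) (metis lessThan_iff not_less)
    with assms(2) show False
      by simp
  qed
  then obtain k where k: "k < d" "y k i < y k j"
    by blast
  let ?y = "y(k := unit_transfer j i (y k))"
  have "\<forall>m<d. vec_of_int (?y m) \<in> permutohedron l"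
    using y permutohedron_unit_transfer[OF y k(2), OF k(1)] by simp
  moreover have "unit_transfer j i z = (\<lambda>i. \<Sum>m<d. ?y m i)"
  proof
    fix n
    \<comment> \<open>Both sums are split at \<open>k\<close>, the only summand that changes, so its
      transfer becomes a transfer of the total.\<close>
    have "(\<Sum>m<d. ?y m n) = unit_transfer j i (y k) n + (\<Sum>m\<in>{..<d} - {k}. y m n)"
      using k(1) by (subst sum.remove[of _ k]) auto
    moreover have "(\<Sum>m<d. y m n') = y k n' + (\<Sum>m\<in>{..<d} - {k}. y m n')" for n'
      using k(1) by (intro sum.remove) auto
    ultimately show "unit_transfer j i z n = (\<Sum>m<d. ?y m n)"
      unfolding z by (auto simp: unit_transfer_def)
  qed
  ultimately show ?thesis
    unfolding lattice_sums_def by blast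
qed

lemma sorted_in_lattice_sums:
  fixes l :: "int ^ 'n::{finite,linorder}"
  assumes l: "mono (($) l)" and "mono x"
    and p: "p \<in> permutohedron l" and x: "vec_of_int x = real d *\<^sub>R p"
  shows "x \<in> lattice_sums d (permutohedron l)"
proof -
  have x_eq: "real_of_int (x i) = real d * p $ i" for i
    using x by (simp add: vec_eq_iff)
  \<comment> \<open>The transfers start from \<open>d\<close> copies of the vertex \<open>l\<close>,
    whose prefix sums are the smallest in the dilate.\<close>
  let ?z = "\<lambda>i. int d * l $ i"
  have "vec_of_int (($) l) \<in> permutohedron l"
    using permutohedron_vertex[OF permutes_id, of l] by simp
  then have z: "?z \<in> lattice_sums d (permutohedron l)"
    unfolding lattice_sums_def by (auto intro!: exI[of _ "\<lambda>_. ($) l"])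
  show ?thesis
  proof (rule mem_if_closed_under_unit_transfers[OF _ \<open>mono x\<close> z])
    fix k
    have "real d * (\<Sum>i\<le>k. real_of_int (l $ i)) \<le> real d * (\<Sum>i\<le>k. p $ i)"
      using permutohedron_prefix_sum[OF l p] by (simp add: mult_left_mono)
    then have "real_of_int (sum ?z {..k}) \<le> real_of_int (sum x {..k})"
      by (simp add: x_eq sum_distrib_left)
    then show "sum ?z {..k} \<le> sum x {..k}"
      by (simp only: of_int_le_iff)
  next
    have "real_of_int (sum ?z UNIV) = real_of_int (sum x UNIV)"
      using permutohedron_total_sum[OF p] by (simp add: x_eq sum_distrib_left[symmetric])
    then show "sum ?z UNIV = sum x UNIV"
      by (simp only: of_int_eq_iff)
  qed (rule lattice_sums_permutohedron_unit_transfer)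
qed

theorem corollary6p13:
  fixes l :: "int ^ 'n::{finite,linorder}"
  assumes "l \<in> nonneg_weakly_increasing"
  shows "normal_polytope (permutohedron l)"
  unfolding normal_polytope_def
proof (intro conjI allI impI ballI lattice_polytope_permutohedron)
  fix d :: nat and x
  assume "x \<in> (\<lambda>p. real d *\<^sub>R p) ` permutohedron l \<inter> integer_points"
  then obtain p f where p: "p \<in> permutohedron l"
    and x: "x = real d *\<^sub>R p" "x = vec_of_int f"
    by (auto elim: integer_pointsE)
  have l: "mono (($) l)"
    using assms by (simp add: nonneg_weakly_increasing_def mono_def)
  \<comment> \<open>The transfer argument needs a sorted target, so the coordinates are sorted
    first; the symmetry of the permutohedron keeps the permuted \<open>p\<close> inside.\<close>
  obtain \<pi> where \<pi>: "\<pi> permutes UNIV" "mono (f \<circ> \<pi>)"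
    by (rule exists_sorting_permutation)
  have "vec_of_int (f \<circ> \<pi>) = real d *\<^sub>R (\<chi> i. p $ \<pi> i)"
    using x by (simp add: vec_eq_iff)
  then have "f \<circ> \<pi> \<in> lattice_sums d (permutohedron l)"
    by (rule sorted_in_lattice_sums[OF l \<pi>(2) permutohedron_permute[OF p \<pi>(1)]])
  then obtain y where y: "\<And>k. k < d \<Longrightarrow> vec_of_int (y k) \<in> permutohedron l"
    and sum: "f \<circ> \<pi> = (\<lambda>i. \<Sum>k<d. y k i)"
    by (auto simp: lattice_sums_def)
  \<comment> \<open>The sorting is undone in every summand separately, again by symmetry.\<close>
  let ?y = "\<lambda>k. vec_of_int (y k \<circ> inv \<pi>)"
  have "?y k \<in> permutohedron l" if "k < d" for k
    using permutohedron_permute[OF y[OF that] permutes_inv[OF \<pi>(1)]]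
    by (simp add: vec_of_int_def)
  moreover have "x = (\<Sum>k<d. ?y k)"
  proof -
    have "f i = (\<Sum>k<d. y k (inv \<pi> i))" for i
      using fun_cong[OF sum, of "inv \<pi> i"] permutes_inverses(1)[OF \<pi>(1)] by simp
    then show ?thesis
      using x(2) by (simp add: vec_eq_iff)
  qed
  ultimately show "\<exists>y. (\<forall>k<d. y k \<in> permutohedron l \<inter> integer_points) \<and> x = (\<Sum>k<d. y k)"
    by (intro exI[of _ ?y]) auto
qed

end
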